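(* Let $n\ge 4$ and $k\ge 1$, and let $\mathbf{Q}_{n,k}$ be the set of all quivers $Q$ on $[1,n]$ obtained as follows: take any quiver $\tilde R$ on $[1,n-1]$ with $b_{ij}(\tilde R)\ge 2$ for all $i<j$; let the full subquiver of $Q$ on $[1,n-1]$ be the quiver obtained from $\tilde R$ by mutating successively at $2,1,2,1,\dots,2,1$ ($2k$ mutations, starting with $2$); and let $b_{in}(Q)\ge 2$ ($1\le i\le n-1$) be arbitrary. Then $\mathbf{Q}_{n,k}$ is a fully generic family of quivers. Consequently, $\mathbf{Q}_{n,k}$ together with the mutation sequence $n,\ 1,2,\dots,1,2\ (2k\text{ terms}),\ n-1,n-2,\dots,2,1,\ 2,1,\dots,2,1\ (2k\text{ terms})$ defines a fully generic mutation cycle.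
   Context: A quiver on $[1,n]$ is a finite directed multigraph with no loops and no oriented 2-cycles; quivers are labeled. It is encoded by the skew-symmetric matrix $B(Q)=(b_{ij})$, $b_{ij}>0$ meaning $b_{ij}$ arrows from $i$ to $j$. Mutation at $k$: $\mu[k](Q)$ has $b'_{ij}=-b_{ij}$ if $k\in\{i,j\}$ and $b'_{ij}=b_{ij}+\tfrac12(|b_{ik}|b_{kj}+b_{ik}|b_{kj}|)$ otherwise. The set $\mathrm{Quiv}_n$ of all quivers on $[1,n]$ is identified with $\mathbb{Z}^{\binom n2}$ via $Q\mapsto (b_{ij}(Q))_{1\le i<j\le n}$. For $A,B\subseteq\mathbb{Z}^d$, a map $f:A\to B$ is $\mathbb{Z}$-biregular if it is a bijection and both $f$ and $f^{-1}$ are given by polynomials with integer coefficients in the coordinates. A family $\mathbf{Q}\subseteq \mathrm{Quiv}_n$ is fully generic if it contains a subset which is the image of a $\mathbb{Z}$-biregular map from $\mathbb{Z}_{\ge 0}^{\binom n2}$. A family $\mathbf{Q}$ and a sequence $i_1,\dots,i_N$ define a fully generic mutation cycle if $\mathbf{Q}$ is fully generic and for every $Q\in\mathbf{Q}$ the sequence is a mutation cycle based at $Q$, i.e. consecutive entries are distinct (cyclically), no mutation is applied at an isolated vertex, and mutating $Q$ successively at $i_1,\dots,i_N$ returns $Q$. *)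

theory Defs
  imports Main "HOL-Library.FuncSet"
begin

section \<open>Quivers and mutations\<close>

text \<open>
  A labeled quiver on the vertex set {1..n} is represented by its skew-symmetric
  integer matrix: for b i j > 0 there are b i j arrows from i to j.  Skew-symmetry
  excludes loops and oriented 2-cycles.  Entries outside {1..n} are 0, so that equality
  of quivers is equality of functions.
\<close>

type_synonym quiver = "nat \<Rightarrow> nat \<Rightarrow> int"

definition Quiv :: "nat \<Rightarrow> quiver set" where
  "Quiv n = {b. (\<forall>i j. b j i = - b i j) \<and>
                (\<forall>i j. i \<notin> {1..n} \<or> j \<notin> {1..n} \<longrightarrow> b i j = 0)}"

text \<open>The dividend below is always even, so the integer division is exact.\<close>

definition mutate :: "nat \<Rightarrow> quiver \<Rightarrow> quiver" where
  "mutate k b = (\<lambda>i j. if i = k \<or> j = k then - b i j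
     else b i j + (\<bar>b i k\<bar> * b k j + b i k * \<bar>b k j\<bar>) div 2)"

text \<open>Mutations are applied in list order, the head of the list first.\<close>

definition mutate_seq :: "nat list \<Rightarrow> quiver \<Rightarrow> quiver" where
  "mutate_seq ks b = fold mutate ks b"

definition full_subquiver :: "nat set \<Rightarrow> quiver \<Rightarrow> quiver" where
  "full_subquiver V b = (\<lambda>i j. if i \<in> V \<and> j \<in> V then b i j else 0)"

definition isolated :: "nat \<Rightarrow> quiver \<Rightarrow> nat \<Rightarrow> bool" where
  "isolated n b v \<longleftrightarrow> (\<forall>j\<in>{1..n}. b v j = 0)"

text \<open>Consecutive entries are compared cyclically: the last one also with the first.\<close>

definition mutation_cycle :: "nat \<Rightarrow> quiver \<Rightarrow> nat list \<Rightarrow> bool" where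
  "mutation_cycle n b ks \<longleftrightarrow>
     ks \<noteq> [] \<and> set ks \<subseteq> {1..n} \<and>
     (\<forall>r<length ks. ks ! r \<noteq> ks ! ((r + 1) mod length ks)) \<and>
     (\<forall>r<length ks. \<not> isolated n (mutate_seq (take r ks) b) (ks ! r)) \<and>
     mutate_seq ks b = b"

section \<open>Integer polynomials and biregular maps\<close>

text \<open>
  For finite I, integer points with coordinates indexed by I are the extensional
  functions on I.  In a polynomial expression each m in M is an exponent vector, and c m is
  the coefficient of the corresponding monomial.
\<close>

definition int_polynomial :: "'i set \<Rightarrow> (('i \<Rightarrow> int) \<Rightarrow> int) \<Rightarrow> bool" where
  "int_polynomial I p \<longleftrightarrow>
     (\<exists>(M :: ('i \<Rightarrow> nat) set) (c :: ('i \<Rightarrow> nat) \<Rightarrow> int). finite M \<and>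
        (\<forall>x. p x = (\<Sum>m\<in>M. c m * (\<Prod>v\<in>I. x v ^ m v))))"

definition given_by_int_polynomials ::
    "'i set \<Rightarrow> ('i \<Rightarrow> int) set \<Rightarrow> (('i \<Rightarrow> int) \<Rightarrow> ('i \<Rightarrow> int)) \<Rightarrow> bool" where
  "given_by_int_polynomials I A f \<longleftrightarrow>
     (\<forall>i\<in>I. \<exists>p. int_polynomial I p \<and> (\<forall>x\<in>A. f x i = p x))"

definition Z_biregular ::
    "'i set \<Rightarrow> ('i \<Rightarrow> int) set \<Rightarrow> ('i \<Rightarrow> int) set \<Rightarrow> (('i \<Rightarrow> int) \<Rightarrow> ('i \<Rightarrow> int)) \<Rightarrow> bool" where
  "Z_biregular I A B f \<longleftrightarrow>
     finite I \<and> A \<subseteq> (I \<rightarrow>\<^sub>E UNIV) \<and> B \<subseteq> (I \<rightarrow>\<^sub>E UNIV) \<and> bij_betw f A B \<and>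
     given_by_int_polynomials I A f \<and> given_by_int_polynomials I B (inv_into A f)"

section \<open>Fully generic families\<close>

text \<open>
  The n choose 2 coordinates are indexed by the pairs i < j; coords is the
  identification of quivers with integer points.
\<close>

definition pairs :: "nat \<Rightarrow> (nat \<times> nat) set" where
  "pairs n = {(i, j). 1 \<le> i \<and> i < j \<and> j \<le> n}"

definition coords :: "nat \<Rightarrow> quiver \<Rightarrow> (nat \<times> nat \<Rightarrow> int)" where
  "coords n b = (\<lambda>(i, j)\<in>pairs n. b i j)"

definition fully_generic :: "nat \<Rightarrow> quiver set \<Rightarrow> bool" where
  "fully_generic n F \<longleftrightarrow>
     F \<subseteq> Quiv n \<and>
     (\<exists>S f. S \<subseteq> F \<and> Z_biregular (pairs n) (pairs n \<rightarrow>\<^sub>E {0..}) (coords n ` S) f)"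

definition fully_generic_mutation_cycle :: "nat \<Rightarrow> quiver set \<Rightarrow> nat list \<Rightarrow> bool" where
  "fully_generic_mutation_cycle n F ks \<longleftrightarrow>
     fully_generic n F \<and> (\<forall>b\<in>F. mutation_cycle n b ks)"

section \<open>The family and its mutation sequence\<close>

definition Q_family :: "nat \<Rightarrow> nat \<Rightarrow> quiver set" where
  "Q_family n k = {b \<in> Quiv n.
     (\<exists>R\<in>Quiv (n - 1).
        (\<forall>i j. 1 \<le> i \<and> i < j \<and> j \<le> n - 1 \<longrightarrow> R i j \<ge> 2) \<and>
        full_subquiver {1..n - 1} b = mutate_seq (concat (replicate k [2, 1])) R) \<and>
     (\<forall>i\<in>{1..n - 1}. b i n \<ge> 2)}"

definition cycle_seq :: "nat \<Rightarrow> nat \<Rightarrow> nat list" where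
  "cycle_seq n k =
     [n] @ concat (replicate k [1, 2]) @ rev [1..<n] @ concat (replicate k [2, 1])"

end

theory Submission
  imports Defs
begin

text \<open>
  Let R be the acyclic quiver on the first n - 1 vertices and a = R 1 2. Mutating R at 2 and then at 1
  changes only the pairs (b 1 j, b 2 j), and these by a fixed linear map "twist a" of determinant 1
  with polynomial inverse; this gives full genericity.

  In the cycle, mutating at n makes n a source, and the extended quiver is then the image under
  (2, 1, ..., 2, 1) of a quiver restricting to R whose n-th column is obtained by untwisting. So
  1, 2, ..., 1, 2 undoes these mutations. The next mutations n - 1, ..., 3 are at sinks, and the
  last k + 1 pairs 2, 1 act on the n-th column as follows: the first flips R back and adds some arrows
  from the vertices j = 3, ..., n - 1 to n, the next k - 1 twist the entries (1, n), (2, n), and the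
  last one removes arrows from j to n. The added and removed numbers are values of a bilinear
  form invariant under the twist, hence they agree.
\<close>

section \<open>Mutation of skew-symmetric matrices\<close>

definition skew :: "quiver \<Rightarrow> bool" where
  "skew b \<longleftrightarrow> (\<forall>i j. b j i = - b i j)"

lemma skewD: "skew b \<Longrightarrow> b j i = - b i j"
  unfolding skew_def by blast

lemma skew_diag [simp]: "skew b \<Longrightarrow> b i i = 0"
  using skewD[of b i i] by simp

lemma Quiv_skew: "b \<in> Quiv n \<Longrightarrow> skew b"
  unfolding Quiv_def skew_def by blast

lemma Quiv_zero: "b \<in> Quiv n \<Longrightarrow> i \<notin> {1..n} \<or> j \<notin> {1..n} \<Longrightarrow> b i j = 0"
  unfolding Quiv_def by blast

lemma Quiv_eqI:
  assumes "b \<in> Quiv n" "c \<in> Quiv n"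
    and "\<And>i j. 1 \<le> i \<Longrightarrow> i < j \<Longrightarrow> j \<le> n \<Longrightarrow> b i j = c i j"
  shows "b = c"
proof (intro ext)
  fix i j
  have sk: "skew b" "skew c" using assms Quiv_skew by auto
  consider "i \<notin> {1..n} \<or> j \<notin> {1..n}" | "i = j" | "1 \<le> i" "i < j" "j \<le> n" | "1 \<le> j" "j < i" "i \<le> n"
    unfolding atLeastAtMost_iff by linarith
  then show "b i j = c i j"
  proof cases
    case 1
    then show ?thesis using Quiv_zero[OF assms(1)] Quiv_zero[OF assms(2)] by metis
  next
    case 4
    then show ?thesis using assms(3)[of j i] skewD[OF sk(1), of j i] skewD[OF sk(2), of j i] by simp
  next
    case 3
    then show ?thesis by (rule assms(3))
  qed (use sk in simp)
qed

text \<open>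
  The signed number of paths from i to j through k, in terms of x = b k i and y = b k j.
\<close>

definition two_paths :: "int \<Rightarrow> int \<Rightarrow> int" where
  "two_paths x y = max 0 (- x) * max 0 y - max 0 x * max 0 (- y)"

lemma two_paths_same_sign [simp]:
  "0 \<le> x \<Longrightarrow> 0 \<le> y \<Longrightarrow> two_paths x y = 0"
  "x \<le> 0 \<Longrightarrow> y \<le> 0 \<Longrightarrow> two_paths x y = 0"
  by (auto simp: two_paths_def max_def)

lemma two_paths_opposite:
  "x \<le> 0 \<Longrightarrow> 0 \<le> y \<Longrightarrow> two_paths x y = - (x * y)"
  "0 \<le> x \<Longrightarrow> y \<le> 0 \<Longrightarrow> two_paths x y = x * y"
  by (auto simp: two_paths_def max_def)

lemma two_paths_commute: "two_paths y x = - two_paths x y"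
  by (simp add: two_paths_def mult.commute)

lemma two_paths_uminus: "two_paths (- x) (- y) = - two_paths x y"
  by (simp add: two_paths_def)

lemma two_paths_eq_div: "(\<bar>- x\<bar> * y + (- x) * \<bar>y\<bar>) div 2 = two_paths x y"
proof -
  have "\<bar>- x\<bar> * y + (- x) * \<bar>y\<bar> = 2 * two_paths x y"
    by (auto simp: two_paths_def max_def abs_if)
  then show ?thesis by simp
qed

lemma mutate_at: "i = k \<or> j = k \<Longrightarrow> mutate k b i j = - b i j"
  by (auto simp: mutate_def)

lemma mutate_off:
  assumes "skew b" "i \<noteq> k" "j \<noteq> k"
  shows "mutate k b i j = b i j + two_paths (b k i) (b k j)"
proof -
  have "b i k = - b k i" by (rule skewD[OF assms(1)])
  then show ?thesis using assms(2,3) two_paths_eq_div[of "b k i" "b k j"] by (simp add: mutate_def)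
qed

lemma skew_mutate [simp]: "skew b \<Longrightarrow> skew (mutate k b)"
  unfolding skew_def[of "mutate k b"]
proof (intro allI)
  fix i j assume b: "skew b"
  show "mutate k b j i = - mutate k b i j"
  proof (cases "i = k \<or> j = k")
    case True
    then have "mutate k b j i = - b j i" "mutate k b i j = - b i j" by (auto intro: mutate_at)
    then show ?thesis using skewD[OF b, of i j] by linarith
  next
    case False
    then show ?thesis
      using mutate_off[OF b, of i k j] mutate_off[OF b, of j k i] skewD[OF b, of i j]
        two_paths_commute[of "b k i" "b k j"] by linarith
  qed
qed

lemma mutate_Quiv [simp]: "b \<in> Quiv n \<Longrightarrow> mutate k b \<in> Quiv n"
proof -
  assume b: "b \<in> Quiv n"
  have "mutate k b i j = 0" if "i \<notin> {1..n} \<or> j \<notin> {1..n}" for i j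
  proof -
    have "b i j = 0" "b i k = 0 \<or> b k j = 0" using that Quiv_zero[OF b] by blast+
    then show ?thesis by (auto simp: mutate_def)
  qed
  then show ?thesis
    using skew_mutate[OF Quiv_skew[OF b], of k] unfolding Quiv_def skew_def by blast
qed

text \<open>Reversing the arrows at \<open>k\<close> exchanges the paths from i through
  \<open>k\<close> to j with those from j to i, so the second change cancels the first.\<close>

lemma mutate_mutate [simp]:
  assumes "skew b"
  shows "mutate k (mutate k b) = b"
proof (intro ext)
  fix i j
  show "mutate k (mutate k b) i j = b i j"
    using assms by (cases "i = k \<or> j = k") (auto simp: mutate_at mutate_off two_paths_uminus)
qed

lemma mutate_seq_Nil [simp]: "mutate_seq [] b = b"
  and mutate_seq_Cons [simp]: "mutate_seq (k # ks) b = mutate_seq ks (mutate k b)"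
  and mutate_seq_append [simp]: "mutate_seq (ks @ ls) b = mutate_seq ls (mutate_seq ks b)"
  by (simp_all add: mutate_seq_def)

lemma mutate_seq_Quiv [simp]: "b \<in> Quiv n \<Longrightarrow> mutate_seq ks b \<in> Quiv n"
  by (induction ks arbitrary: b) auto

lemma mutate_seq_rev:
  "skew b \<Longrightarrow> mutate_seq (rev ks) (mutate_seq ks b) = b"
  by (induction ks arbitrary: b) auto

section \<open>Mutation at sinks as reversal of arrows\<close>

definition sign_flip :: "nat set \<Rightarrow> quiver \<Rightarrow> quiver" where
  "sign_flip V b = (\<lambda>i j. if (i \<in> V) \<noteq> (j \<in> V) then - b i j else b i j)"

lemma skew_sign_flip [simp]: "skew b \<Longrightarrow> skew (sign_flip V b)"
  unfolding skew_def[of "sign_flip V b"]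
proof (intro allI)
  fix i j assume "skew b"
  then show "sign_flip V b j i = - sign_flip V b i j"
    using skewD[of b i j] by (auto simp: sign_flip_def simp del: skew_diag)
qed

text \<open>No path passes through a sink, so mutation there only reverses the arrows at it.\<close>

lemma mutate_sink:
  assumes "skew b" "\<And>i. 0 \<le> b i k"
  shows "mutate k b = sign_flip {k} b"
proof (intro ext)
  fix i j
  have "b k i \<le> 0" for i using assms(2)[of i] skewD[OF assms(1), of i k] by simp
  then show "mutate k b i j = sign_flip {k} b i j"
    using assms(1) by (cases "i = k \<or> j = k") (auto simp: mutate_at mutate_off sign_flip_def)
qed

section \<open>Admissible mutation sequences\<close>

text \<open>Recursive form of the non-isolation clause of \<open>mutation_cycle\<close>; it splits
  along concatenation of sequences.\<close>

fun admissible :: "nat \<Rightarrow> nat list \<Rightarrow> quiver \<Rightarrow> bool" where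
  "admissible n [] b \<longleftrightarrow> True"
| "admissible n (k # ks) b \<longleftrightarrow> \<not> isolated n b k \<and> admissible n ks (mutate k b)"

lemma admissible_append [simp]:
  "admissible n (ks @ ls) b \<longleftrightarrow> admissible n ks b \<and> admissible n ls (mutate_seq ks b)"
  by (induction ks arbitrary: b) auto

lemma admissible_iff_nth:
  "admissible n ks b \<longleftrightarrow> (\<forall>r<length ks. \<not> isolated n (mutate_seq (take r ks) b) (ks ! r))"
  by (induction ks arbitrary: b) (auto simp: All_less_Suc2)

text \<open>A mutation at 1 or 2 only negates the entry between these two vertices, so each of them
  always keeps the other as a neighbour.\<close>

lemma admissible_12:
  assumes "set ks \<subseteq> {1, 2}" "skew b" "b 1 2 \<noteq> 0" "n \<ge> 2"
  shows "admissible n ks b"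
  using assms
proof (induction ks arbitrary: b)
  case (Cons k ks)
  have "b 2 1 \<noteq> 0" using Cons.prems skewD[of b 1 2] by simp
  then have "\<not> isolated n b k" 
    using Cons.prems by (force simp: isolated_def)
  moreover have "mutate k b 1 2 \<noteq> 0" using Cons.prems by (auto simp: mutate_at)
  ultimately show ?case using Cons by simp
qed auto

text \<open>When the turn of \<open>m\<close> comes, its arrows to m + 1, ..., n - 1 have been
  reversed by the earlier mutations, and all its other arrows entered it already, so it is a sink.
  The bound \<open>p\<close> stays fixed while \<open>m\<close> descends; \<open>1 < p\<close> keeps
  vertex 1 outside the flipped set, as a neighbour showing that \<open>m\<close> is not
  isolated.\<close>

lemma sink_sequence:
  assumes "skew c" "p \<le> m" "m \<le> n" "1 < p"
    and "\<And>i j. p \<le> j \<Longrightarrow> j < n \<Longrightarrow> i < j \<Longrightarrow> 0 \<le> c i j"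
    and "\<And>i j. p \<le> j \<Longrightarrow> j < n \<Longrightarrow> n \<le> i \<Longrightarrow> 0 \<le> c i j"
    and "\<And>j. p \<le> j \<Longrightarrow> j < n \<Longrightarrow> c 1 j \<noteq> 0"
  shows "mutate_seq (rev [m..<n]) c = sign_flip {m..<n} c \<and> admissible n (rev [m..<n]) c"
  using assms(3,2)
proof (induction m rule: inc_induct)
  case base
  then show ?case by (simp add: sign_flip_def)
next
  case (step m)
  let ?d = "sign_flip {Suc m..<n} c"
  have IH: "mutate_seq (rev [Suc m..<n]) c = ?d" "admissible n (rev [Suc m..<n]) c"
    using step by auto
  have sk: "skew ?d" using assms(1) by simp
  have "0 \<le> ?d i m" for i
  proof -
    consider "i < m" | "i = m" | "m < i" "i < n" | "n \<le> i" by linarith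
    then show ?thesis
    proof cases
      case 3
      then have "0 \<le> c m i" using assms(5)[of i m] step by simp
      then show ?thesis using 3 skewD[OF assms(1), of m i] by (simp add: sign_flip_def)
    qed (use assms(1,5,6) step in \<open>auto simp: sign_flip_def\<close>)
  qed
  then have "mutate m ?d = sign_flip {m} ?d" by (rule mutate_sink[OF sk])
  \<comment> \<open>Arrows between \<open>m\<close> and the later vertices are reversed twice, hence
    keep their direction inside the larger flipped set.\<close>
  also have "\<dots> = sign_flip {m..<n} c"
    using step by (intro ext) (auto simp: sign_flip_def)
  finally have "mutate m ?d = sign_flip {m..<n} c" .
  moreover have "\<not> isolated n ?d m"
  proof -
    have "c m 1 \<noteq> 0" using assms(7)[of m] step skewD[OF assms(1), of m 1] by simp
    then have "?d m 1 \<noteq> 0" using assms(4) step by (simp add: sign_flip_def)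
    moreover have "1 \<in> {1..n}" using step by simp
    ultimately show ?thesis unfolding isolated_def by blast
  qed
  moreover have "rev [m..<n] = rev [Suc m..<n] @ [m]" using step by (simp add: upt_rec[of m])
  ultimately show ?case using IH by simp
qed

section \<open>Alternating words and cyclic distinctness\<close>

lemma cyclically_distinct:
  assumes "distinct_adj ks" "ks \<noteq> []" "hd ks \<noteq> last ks" "r < length ks"
  shows "ks ! r \<noteq> ks ! ((r + 1) mod length ks)"
proof (cases "r + 1 = length ks")
  case True
  then show ?thesis using assms by (simp add: hd_conv_nth last_conv_nth flip: True)
next
  case False
  then show ?thesis using assms by (simp add: distinct_adj_conv_nth)
qed

lemma distinct_adj_alternating:
  "x \<noteq> y \<Longrightarrow> distinct_adj (concat (replicate k [x, y]))"
proof (induction k)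
  case (Suc k)
  then show ?case by (cases k) auto
qed simp

lemma alternating_Suc:
  "concat (replicate (Suc k) xs) = concat (replicate k xs) @ xs"
  by (induction k) simp_all

lemma rev_alternating: "rev (concat (replicate k [x, y])) = concat (replicate k [y, x])"
  by (simp add: rev_concat)

section \<open>Mutating alternately at the vertices 2 and 1\<close>

abbreviation alt_mutate :: "nat \<Rightarrow> quiver \<Rightarrow> quiver" where
  "alt_mutate k \<equiv> mutate_seq (concat (replicate k [2, 1]))"

lemma alt_mutate_Suc: "alt_mutate (Suc k) b = mutate 1 (mutate 2 (alt_mutate k b))"
  unfolding alternating_Suc by simp

text \<open>Since b 2 1 = - a is not positive, mutation at 2 adds to row 1 the paths from 1 through
  2 to j; \<open>v\<close> is the resulting row. The \<open>a\<close> arrows then run from 2 to 1,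
  so mutation at 1 adds to row 2 the paths from 2 through 1 to j.\<close>

lemma mutate_21:
  fixes a :: int
  assumes "skew b" "b 1 2 = a" "0 \<le> a"
  defines "v \<equiv> (\<lambda>j. b 1 j + a * max 0 (b 2 j))"
  shows "mutate 1 (mutate 2 b) 1 2 = a"
    and "j \<notin> {1, 2} \<Longrightarrow> mutate 1 (mutate 2 b) 1 j = - v j"
    and "j \<notin> {1, 2} \<Longrightarrow> mutate 1 (mutate 2 b) 2 j = - b 2 j + a * max 0 (v j)"
    and "i \<notin> {1, 2} \<Longrightarrow> j \<notin> {1, 2} \<Longrightarrow> mutate 1 (mutate 2 b) i j
           = b i j + two_paths (b 2 i) (b 2 j) + two_paths (v i) (v j)"
proof -
  have b21: "b 2 1 = - a" using skewD[OF assms(1), of 2 1] assms(2) by simp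
  have tp: "two_paths (- a) y = a * max 0 y" for y
    using assms(3) by (simp add: two_paths_def)
  have m1: "mutate 2 b 1 j = v j" if "j \<notin> {1, 2}" for j
    using that assms(1) b21 by (simp add: mutate_off tp v_def)
  have m12: "mutate 2 b 1 2 = - a" using assms(2) by (simp add: mutate_at)
  show "mutate 1 (mutate 2 b) 1 2 = a" using assms(2) by (simp add: mutate_at)
  show "mutate 1 (mutate 2 b) 1 j = - v j" if "j \<notin> {1, 2}"
    using m1[OF that] by (simp add: mutate_at)
  show "mutate 1 (mutate 2 b) 2 j = - b 2 j + a * max 0 (v j)" if "j \<notin> {1, 2}"
    using that assms(1) m1[OF that] m12 mutate_off[of "mutate 2 b" 2 1 j]
    by (simp add: mutate_at[of 2 2] tp)
  show "mutate 1 (mutate 2 b) i j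
           = b i j + two_paths (b 2 i) (b 2 j) + two_paths (v i) (v j)"
    if "i \<notin> {1, 2}" "j \<notin> {1, 2}"
    using that assms(1) m1[OF that(1)] m1[OF that(2)] by (simp add: mutate_off)
qed

text \<open>
  With a = b 1 2, these maps describe the effect of mutating at 2 and then at 1, and of undoing it,
  on the pair (b 1 j, b 2 j), as long as there is no arrow from j to the mutated vertex.
\<close>

fun twist :: "int \<Rightarrow> int \<times> int \<Rightarrow> int \<times> int" where
  "twist a (u, w) = (- (u + a * w), a * (u + a * w) - w)"

fun untwist :: "int \<Rightarrow> int \<times> int \<Rightarrow> int \<times> int" where
  "untwist a (u, w) = (- u + a * (w + a * u), - w - a * u)"

text \<open>Here \<open>w\<close> is the entry b 2 j met by the mutation at 2, and
  \<open>u + a * w\<close> is the entry b 1 j met by the subsequent mutation at 1.\<close>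

fun outgoing :: "int \<Rightarrow> int \<times> int \<Rightarrow> bool" where
  "outgoing a (u, w) \<longleftrightarrow> 0 \<le> w \<and> 0 \<le> u + a * w"

lemma untwist_twist [simp]: "untwist a (twist a p) = p"
  by (cases p) (simp add: algebra_simps)

lemma twist_untwist [simp]: "twist a (untwist a p) = p"
  by (cases p) (simp add: algebra_simps)

lemma untwist_twist_pow [simp]: "(untwist a ^^ k) ((twist a ^^ k) p) = p"
  by (induction k arbitrary: p) (simp_all add: funpow_swap1)

lemma twist_untwist_pow:
  "s \<le> k \<Longrightarrow> (twist a ^^ s) ((untwist a ^^ k) p) = (untwist a ^^ (k - s)) p"
proof (induction s)
  case (Suc s)
  then have "k - s = Suc (k - Suc s)" by simp
  then show ?case using Suc by simp
qed simp

text \<open>\<open>twist a\<close> preserves neither \<open>outgoing\<close> nor positivity of both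
  entries, hence this invariant. With q = u + a * w, the bound a \<ge> 2 gives q \<ge> w, so the new
  pair (- q, a * q - w) has a * q - w \<ge> q > 0.\<close>

lemma twist_pow_increasing:
  assumes "2 \<le> a" "0 < w" "0 \<le> u + w"
  shows "0 < snd ((twist a ^^ k) (u, w)) \<and> 0 \<le> fst ((twist a ^^ k) (u, w)) + snd ((twist a ^^ k) (u, w))"
proof (induction k)
  case (Suc k)
  obtain x y where xy: "(twist a ^^ k) (u, w) = (x, y)" by (cases "(twist a ^^ k) (u, w)")
  have y: "0 < y" "0 \<le> x + y" using Suc xy by auto
  have "2 * y \<le> a * y" using assms(1) y by simp
  then have q: "y \<le> x + a * y" using y by linarith
  then have "2 * (x + a * y) \<le> a * (x + a * y)" using assms(1) y by (intro mult_right_mono) auto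
  then show ?case using q y xy by simp
qed (use assms in simp)

lemma outgoing_twist_pow:
  assumes "2 \<le> a" "0 < w" "0 \<le> u + w"
  shows "outgoing a ((twist a ^^ k) (u, w))"
proof -
  obtain x y where xy: "(twist a ^^ k) (u, w) = (x, y)" by (cases "(twist a ^^ k) (u, w)")
  have y: "0 < y" "0 \<le> x + y" using twist_pow_increasing[OF assms, of k] xy by auto
  moreover have "2 * y \<le> a * y" using assms(1) y by simp
  ultimately have "0 \<le> x + a * y" by linarith
  then show ?thesis using xy y by simp
qed

text \<open>With t = - w - a * u, the bound a \<ge> 2 gives t \<ge> - u \<ge> 0, and the new pair is
  (- u - a * t, t), where - u - a * t \<le> t - 2 * t = - t.\<close>

lemma untwist_pow_decreasing:
  assumes "2 \<le> a" "u \<le> 0" "w \<le> - u"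
  shows "fst ((untwist a ^^ k) (u, w)) \<le> 0 \<and> snd ((untwist a ^^ k) (u, w)) \<le> - fst ((untwist a ^^ k) (u, w))"
proof (induction k)
  case (Suc k)
  obtain x y where xy: "(untwist a ^^ k) (u, w) = (x, y)" by (cases "(untwist a ^^ k) (u, w)")
  have y: "x \<le> 0" "y \<le> - x" using Suc xy by auto
  have "2 * (- x) \<le> a * (- x)" using assms(1) y by (intro mult_right_mono) auto
  then have q: "- x \<le> - y - a * x" using y by simp
  then have "2 * (- y - a * x) \<le> a * (- y - a * x)" using assms(1) y by (intro mult_right_mono) auto
  then have "2 * (- y - a * x) \<le> - (a * (y + a * x))" by (simp add: algebra_simps)
  then show ?case using q y xy by simp
qed (use assms in simp)

text \<open>The last untwist turns a pair (x, y) into one with second entry - y - a * x, for which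
  \<open>u + a * w\<close> equals - x; both are nonnegative. At least one untwist is required, since
  a starting pair with two negative entries is not outgoing.\<close>

lemma outgoing_untwist_pow:
  assumes "2 \<le> a" "u \<le> 0" "w \<le> - u"
  shows "outgoing a ((untwist a ^^ Suc k) (u, w))"
proof -
  obtain x y where xy: "(untwist a ^^ k) (u, w) = (x, y)" by (cases "(untwist a ^^ k) (u, w)")
  have y: "x \<le> 0" "y \<le> - x" using untwist_pow_decreasing[OF assms, of k] xy by auto
  have "2 * (- x) \<le> a * (- x)" using assms(1) y by (intro mult_right_mono) auto
  then show ?thesis using xy y by (simp add: algebra_simps)
qed

text \<open>Outgoing signs make every \<open>max 0\<close> in \<open>mutate_21\<close> act as the
  identity, which leaves \<open>twist a\<close>, and exclude paths through 2 or 1 between vertices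
  of \<open>J\<close>. Only the stages \<open>s < k\<close> are constrained: the final pair may have
  any signs, as happens in the n-th column of the cycle.\<close>

lemma alt_mutate_twist:
  fixes a :: int
  assumes "skew b" "b 1 2 = a" "0 \<le> a" "J \<inter> {1, 2} = {}"
    and "\<And>s j. s < k \<Longrightarrow> j \<in> J \<Longrightarrow> outgoing a ((twist a ^^ s) (b 1 j, b 2 j))"
  shows "skew (alt_mutate k b)"
    and "alt_mutate k b 1 2 = a"
    and "j \<in> J \<Longrightarrow> (alt_mutate k b 1 j, alt_mutate k b 2 j) = (twist a ^^ k) (b 1 j, b 2 j)"
    and "i \<in> J \<Longrightarrow> j \<in> J \<Longrightarrow> alt_mutate k b i j = b i j"
proof -
  have "skew (alt_mutate k b) \<and> alt_mutate k b 1 2 = a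
    \<and> (\<forall>j\<in>J. (alt_mutate k b 1 j, alt_mutate k b 2 j) = (twist a ^^ k) (b 1 j, b 2 j))
    \<and> (\<forall>i\<in>J. \<forall>j\<in>J. alt_mutate k b i j = b i j)"
    using assms(5)
  proof (induction k)
    case 0
    then show ?case using assms(1,2) by simp
  next
    case (Suc k)
    let ?c = "alt_mutate k b"
    have IH: "skew ?c" "?c 1 2 = a"
      "\<And>j. j \<in> J \<Longrightarrow> (twist a ^^ k) (b 1 j, b 2 j) = (?c 1 j, ?c 2 j)"
      "\<And>i j. i \<in> J \<Longrightarrow> j \<in> J \<Longrightarrow> ?c i j = b i j"
      using Suc by auto
    have out: "0 \<le> ?c 2 j \<and> 0 \<le> ?c 1 j + a * ?c 2 j" if "j \<in> J" for j
      using Suc.prems[of k j] that IH(3)[OF that] by simp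
    have nin: "j \<notin> {1, 2}" if "j \<in> J" for j using assms(4) that by blast
    note m = mutate_21[OF IH(1,2) assms(3)]
    show ?case unfolding alt_mutate_Suc
    proof (intro conjI ballI)
      show "skew (mutate 1 (mutate 2 ?c))" using IH(1) by simp
      show "mutate 1 (mutate 2 ?c) 1 2 = a" by (rule m)
      fix j assume j: "j \<in> J"
      show "(mutate 1 (mutate 2 ?c) 1 j, mutate 1 (mutate 2 ?c) 2 j)
          = (twist a ^^ Suc k) (b 1 j, b 2 j)"
        using m(2,3)[OF nin[OF j]] out[OF j] IH(3)[OF j] by simp
    next
      fix i j assume ij: "i \<in> J" "j \<in> J"
      show "mutate 1 (mutate 2 ?c) i j = b i j"
        using m(4)[OF nin[OF ij(1)] nin[OF ij(2)]] out[OF ij(1)] out[OF ij(2)] IH(4)[OF ij]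
        by simp
    qed
  qed
  then show "skew (alt_mutate k b)" "alt_mutate k b 1 2 = a"
    "j \<in> J \<Longrightarrow> (alt_mutate k b 1 j, alt_mutate k b 2 j) = (twist a ^^ k) (b 1 j, b 2 j)"
    "i \<in> J \<Longrightarrow> j \<in> J \<Longrightarrow> alt_mutate k b i j = b i j"
    by auto
qed

text \<open>With C the Gram matrix with rows (1, 0) and (a, 1), \<open>twist a\<close> is - C^(-1)
  C^T, which preserves C. Up to the sign of one coordinate these are the Euler form and the Coxeter
  transformation of the Kronecker quiver with \<open>a\<close> arrows.\<close>

fun twist_form :: "int \<Rightarrow> int \<times> int \<Rightarrow> int \<times> int \<Rightarrow> int" where
  "twist_form a (x, y) (u, w) = x * u + y * w + a * y * u"

lemma twist_form_invariant: "twist_form a ((twist a ^^ k) p) ((twist a ^^ k) q) = twist_form a p q"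
proof -
  have "twist_form a (twist a p) (twist a q) = twist_form a p q" for p q
    by (cases p; cases q) (simp add: algebra_simps)
  then show ?thesis by (induction k) auto
qed

section \<open>The quivers of the family\<close>

definition abundant_acyclic :: "nat \<Rightarrow> quiver \<Rightarrow> bool" where
  "abundant_acyclic m R \<longleftrightarrow> R \<in> Quiv m \<and> (\<forall>i j. 1 \<le> i \<and> i < j \<and> j \<le> m \<longrightarrow> 2 \<le> R i j)"

text \<open>Entries at least 2 start in the range of \<open>twist_pow_increasing\<close>, so every
  column stays outgoing at all stages.\<close>

lemma abundant_acyclic_twist:
  assumes "abundant_acyclic m R" "m \<ge> 3"
  defines "a \<equiv> R 1 2"
  shows "alt_mutate k R 1 2 = a"
    and "3 \<le> j \<Longrightarrow> j \<le> m \<Longrightarrow> (alt_mutate k R 1 j, alt_mutate k R 2 j) = (twist a ^^ k) (R 1 j, R 2 j)"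
    and "3 \<le> i \<Longrightarrow> i \<le> m \<Longrightarrow> 3 \<le> j \<Longrightarrow> j \<le> m \<Longrightarrow> alt_mutate k R i j = R i j"
    and "3 \<le> j \<Longrightarrow> j \<le> m \<Longrightarrow> outgoing a ((twist a ^^ k) (R 1 j, R 2 j))"
proof -
  have R: "R \<in> Quiv m" "\<And>i j. 1 \<le> i \<Longrightarrow> i < j \<Longrightarrow> j \<le> m \<Longrightarrow> 2 \<le> R i j"
    using assms(1) by (auto simp: abundant_acyclic_def)
  have a: "2 \<le> a" using R(2)[of 1 2] assms by simp
  have out: "outgoing a ((twist a ^^ k) (R 1 j, R 2 j))" if "j \<in> {3..m}" for j k
    using R(2)[of 1 j] R(2)[of 2 j] that a by (intro outgoing_twist_pow) auto
  have m: "skew R" "R 1 2 = a" "0 \<le> a" "{3..m} \<inter> {1, 2} = {}"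
    using R a Quiv_skew by (auto simp: a_def)
  note tw = alt_mutate_twist[OF m, of k]
  show "alt_mutate k R 1 2 = a" using tw(2) out by blast
  show "(alt_mutate k R 1 j, alt_mutate k R 2 j) = (twist a ^^ k) (R 1 j, R 2 j)" if "3 \<le> j" "j \<le> m"
    using tw(3)[of j] out that by auto
  show "alt_mutate k R i j = R i j" if "3 \<le> i" "i \<le> m" "3 \<le> j" "j \<le> m"
    using tw(4)[of i j] out that by auto
  show "outgoing a ((twist a ^^ k) (R 1 j, R 2 j))" if "3 \<le> j" "j \<le> m"
    using out that by auto
qed

section \<open>The extended quiver and the mutation cycle\<close>

definition add_vertex :: "nat \<Rightarrow> quiver \<Rightarrow> (nat \<Rightarrow> int) \<Rightarrow> quiver" where
  "add_vertex n R x = (\<lambda>i j. if i = n then if j \<in> {1..<n} then - x j else 0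
     else if j = n then if i \<in> {1..<n} then x i else 0 else R i j)"

lemma add_vertex_Quiv:
  assumes "R \<in> Quiv (n - 1)"
  shows "add_vertex n R x \<in> Quiv n"
proof -
  have "add_vertex n R x j i = - add_vertex n R x i j" for i j
    using skewD[OF Quiv_skew[OF assms], of j i] by (simp add: add_vertex_def)
  moreover have "add_vertex n R x i j = 0" if "i \<notin> {1..n} \<or> j \<notin> {1..n}" for i j
  proof -
    have "i \<notin> {1..n - 1} \<or> j \<notin> {1..n - 1}" using that by auto
    then have "R i j = 0" by (rule Quiv_zero[OF assms])
    then show ?thesis using that by (auto simp: add_vertex_def)
  qed
  ultimately show ?thesis unfolding Quiv_def by blast
qed

lemma Q_family_mutation_cycle:
  assumes "n \<ge> 4" "k \<ge> 1" "b \<in> Q_family n k"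
  shows "mutation_cycle n b (cycle_seq n k)"
proof -
  have bQ: "b \<in> Quiv n" and b_n: "\<And>i. i \<in> {1..n - 1} \<Longrightarrow> 2 \<le> b i n"
    using assms(3) by (auto simp: Q_family_def)
  obtain R where R: "abundant_acyclic (n - 1) R"
    and Rb: "full_subquiver {1..n - 1} b = alt_mutate k R"
    using assms(3) unfolding Q_family_def abundant_acyclic_def by blast
  have RQ: "R \<in> Quiv (n - 1)" and R2: "\<And>i j. 1 \<le> i \<Longrightarrow> i < j \<Longrightarrow> j < n \<Longrightarrow> 2 \<le> R i j"
    using R by (auto simp: abundant_acyclic_def)
  have skb: "skew b" and skR: "skew R" using bQ RQ Quiv_skew by auto
  have b_R: "b i j = alt_mutate k R i j" if "1 \<le> i" "i < n" "1 \<le> j" "j < n" for i j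
  proof -
    have "i \<in> {1..n - 1}" "j \<in> {1..n - 1}" using that by auto
    then show ?thesis
      using fun_cong[OF fun_cong[OF Rb, of i], of j] by (simp add: full_subquiver_def)
  qed
  define a where "a = R 1 2"
  have a: "2 \<le> a" using R2[of 1 2] assms(1) by (simp add: a_def)
  have n1: "n - 1 \<ge> 3" using assms(1) by simp
  note Rt = abundant_acyclic_twist[OF R n1, folded a_def]
  have outR: "outgoing a ((twist a ^^ s) (R 1 j, R 2 j))" if "3 \<le> j" "j < n" for s j
    using Rt(4)[of j s] that by simp
  have twR: "(b 1 j, b 2 j) = (twist a ^^ k) (R 1 j, R 2 j)" if "3 \<le> j" "j < n" for j
    using Rt(2)[of j k] b_R[of 1 j] b_R[of 2 j] that by simp
  have bij: "b i j = R i j" if "3 \<le> i" "i < n" "3 \<le> j" "j < n" for i j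
    using Rt(3)[of i j k] b_R[of i j] that by simp
  have b12: "b 1 2 = a" using Rt(1)[of k] b_R[of 1 2] assms(1) by simp

  \<comment> \<open>\<open>p\<close> is chosen so that \<open>k\<close> twists lead to the n-th
    column of \<open>mutate n b\<close>, whose entries are those of \<open>b\<close>
    negated.\<close>
  define p where "p = (untwist a ^^ k) (- b 1 n, - b 2 n)"
  obtain u w where uw: "p = (u, w)" by (cases p)
  have b1n: "2 \<le> b 1 n" "2 \<le> b 2 n" using b_n assms(1) by auto
  have twp: "(twist a ^^ k) p = (- b 1 n, - b 2 n)"
    using twist_untwist_pow[of k k a] by (simp add: p_def)
  \<comment> \<open>After s < k twists at least one untwist of the original \<open>k\<close> is
    left, as \<open>outgoing_untwist_pow\<close> demands.\<close>
  have outp: "outgoing a ((twist a ^^ s) p)" if "s < k" for s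
  proof -
    have "(twist a ^^ s) p = (untwist a ^^ Suc (k - s - 1)) (- b 1 n, - b 2 n)"
      using that twist_untwist_pow[of s k a] by (simp add: p_def Suc_diff_Suc)
    then show ?thesis using outgoing_untwist_pow[of a] a b1n by simp
  qed
  have outp0: "0 \<le> w" "0 \<le> u + a * w" using outp[of 0] assms(2) uw by auto

  \<comment> \<open>The candidate for the quiver before the \<open>k\<close> pairs 2, 1: entries
    from j = 3, ..., n - 1 to \<open>n\<close> are unaffected by these pairs, so they are already
    those of \<open>mutate n b\<close>.\<close>
  define c where "c = add_vertex n R (\<lambda>i. if i = 1 then u else if i = 2 then w else - b i n)"
  have cQ: "c \<in> Quiv n" unfolding c_def by (rule add_vertex_Quiv[OF RQ])
  then have skc: "skew c" by (rule Quiv_skew)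
  have c_R: "c i j = R i j" if "i < n" "j < n" for i j
    using that by (simp add: c_def add_vertex_def)
  have c_n: "c 1 n = u" "c 2 n = w" "\<And>j. 3 \<le> j \<Longrightarrow> j < n \<Longrightarrow> c j n = - b j n"
    using assms(1) by (auto simp: c_def add_vertex_def)
  have c12: "c 1 2 = a" using c_R[of 1 2] assms(1) by (simp add: a_def)
  have b_col: "0 \<le> b i n" for i
  proof (cases "i \<in> {1..n - 1}")
    case True
    then show ?thesis using b_n[of i] by simp
  next
    case False
    then have "i = n \<or> i \<notin> {1..n}" by auto
    then show ?thesis using Quiv_zero[OF bQ, of i n] skb by auto
  qed
  have step_n: "mutate n b = sign_flip {n} b" by (rule mutate_sink[OF skb b_col])

  have out_c: "outgoing a ((twist a ^^ s) (c 1 j, c 2 j))" if "s < k" "j \<in> {3..n}" for s j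
    using that outp[of s] outR[of j s] c_R[of 1 j] c_R[of 2 j] c_n(1,2) uw by (cases "j = n") auto
  have disj: "{3..n} \<inter> {1, 2} = {}" by auto
  have a0: "0 \<le> a" using a by simp
  note ct = alt_mutate_twist[where J = "{3..n}" and k = k, OF skc c12 a0 disj out_c]
  have "alt_mutate k c = mutate n b" unfolding step_n
  proof (rule Quiv_eqI)
    show "alt_mutate k c \<in> Quiv n" using cQ by simp
    show "sign_flip {n} b \<in> Quiv n" using bQ by (simp flip: step_n)
    fix i j assume ij: "1 \<le> i" "i < j" "j \<le> n"
    have pair: "(alt_mutate k c 1 j, alt_mutate k c 2 j) = (sign_flip {n} b 1 j, sign_flip {n} b 2 j)"
      if "3 \<le> j"
      using that ct(3)[of j] ij twp twR[of j] c_R[of 1 j] c_R[of 2 j] c_n(1,2) uw assms(1)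
      by (cases "j = n") (auto simp: sign_flip_def)
    consider "i = 1" "j = 2" | "3 \<le> j" "i = 1" | "3 \<le> j" "i = 2" | "3 \<le> i" "3 \<le> j"
      using ij by linarith
    then show "alt_mutate k c i j = sign_flip {n} b i j"
    proof cases
      case 1
      then show ?thesis using ct(2) b12 assms(1) by (simp add: sign_flip_def)
    next
      case 4
      then have "alt_mutate k c i j = c i j" using ct(4)[of i j] ij by simp
      then show ?thesis using c_R[of i j] c_n(3)[of i] bij[of i j] 4 ij
        by (cases "j = n") (auto simp: sign_flip_def)
    qed (use pair in auto)
  qed
  then have undo: "mutate_seq (concat (replicate k [1, 2])) (mutate n b) = c"
    using mutate_seq_rev[OF skc, of "concat (replicate k [2, 1])"] by (simp add: rev_alternating)

  define d where "d = sign_flip {3..<n} c"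
  \<comment> \<open>Arrows between j = 3, ..., n - 1 and smaller vertices enter j because
    \<open>c\<close> restricts to \<open>R\<close>; those between j and \<open>n\<close> enter j
    because c j n = - b j n. Indices 0 and beyond \<open>n\<close> give zero entries.\<close>
  have sinks: "mutate_seq (rev [3..<n]) c = d \<and> admissible n (rev [3..<n]) c" unfolding d_def
  proof (rule sink_sequence[OF skc, of 3])
    fix i j assume j: "3 \<le> j" "j < n"
    { assume "i < j"
      then show "0 \<le> c i j"
        using R2[of i j] Quiv_zero[OF RQ, of i j] c_R[of i j] j by (cases "i = 0") auto }
    { assume "n \<le> i"
      then show "0 \<le> c i j"
        using Quiv_zero[OF RQ, of i j] b_col[of j] j by (auto simp: c_def add_vertex_def) }
  next
    fix j assume "3 \<le> j" "j < n"
    then show "c 1 j \<noteq> 0" using R2[of 1 j] c_R[of 1 j] by simp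
  qed (use assms(1) in auto)
  have dQ: "d \<in> Quiv n" using sinks cQ mutate_seq_Quiv by metis
  then have skd: "skew d" by (rule Quiv_skew)
  have d12: "d 1 2 = a" using c12 by (simp add: d_def sign_flip_def)
  have d1: "d 1 j = - R 1 j" "d 2 j = - R 2 j" "d j n = b j n" if "3 \<le> j" "j < n" for j
    using that c_R[of 1 j] c_R[of 2 j] c_n(3)[of j] by (auto simp: d_def sign_flip_def)
  have dn: "d 1 n = u" "d 2 n = w" using c_n by (auto simp: d_def sign_flip_def)
  have dij: "d i j = R i j" if "3 \<le> i" "i < n" "3 \<le> j" "j < n" for i j
    using that c_R[of i j] by (auto simp: d_def sign_flip_def)

  \<comment> \<open>\<open>e\<close> is reached by the pair 2, 1 that ends the descent n - 1, ...,
    1.\<close>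
  define e where "e = mutate 1 (mutate 2 d)"
  have eQ: "e \<in> Quiv n" using dQ by (simp add: e_def)
  then have ske: "skew e" by (rule Quiv_skew)
  note dt = mutate_21[OF skd d12 a0, folded e_def]
  have d_in: "0 \<le> R 1 j" "0 \<le> R 2 j" if "3 \<le> j" "j < n" for j
    using R2[of 1 j] R2[of 2 j] that by auto
  \<comment> \<open>The entries of \<open>d\<close> in these columns are nonpositive, so no
    \<open>max 0\<close> term survives and both signs flip back.\<close>
  have e1: "e 1 j = R 1 j" "e 2 j = R 2 j" if "3 \<le> j" "j < n" for j
    using dt(2,3)[of j] d1[OF that] d_in[OF that] that by auto
  have en: "(e 1 n, e 2 n) = twist a p"
    using dt(2,3)[of n] dn outp0 assms(1) uw by simp
  have eij: "e i j = R i j" if "3 \<le> i" "i < n" "3 \<le> j" "j < n" for i j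
    using dt(4)[of i j] d1[of i] d1[of j] d_in[of i] d_in[of j] dij[of i j] that by auto
  \<comment> \<open>The two added terms count the paths from j to \<open>n\<close> through 2 and,
    after that mutation, through 1.\<close>
  have ejn: "e j n = b j n + R 2 j * w + R 1 j * (u + a * w)" if "3 \<le> j" "j < n" for j
    using dt(4)[of j n] d1[of j] d_in[of j] dn outp0 that assms(1) by (simp add: two_paths_opposite)

  \<comment> \<open>The n-th column of \<open>e\<close> has used one of its \<open>k\<close> twists,
    so only \<open>k - 1\<close> further pairs act on it as twists; the last pair is treated
    separately.\<close>
  obtain l where l: "k = Suc l" using assms(2) by (cases k) auto
  have out_e: "outgoing a ((twist a ^^ s) (e 1 j, e 2 j))" if "s < l" "j \<in> {3..n}" for s j
    using that outp[of "Suc s"] outR[of j s] e1[of j] en l by (cases "j = n") (auto simp: funpow_swap1)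
  define f where "f = alt_mutate l e"
  have fQ: "f \<in> Quiv n" using eQ by (simp add: f_def)
  then have skf: "skew f" by (rule Quiv_skew)
  note et = alt_mutate_twist[where J = "{3..n}" and k = l, OF ske dt(1) a0 disj out_e, folded f_def]
  have fn: "f 1 n = - b 1 n" "f 2 n = - b 2 n"
    using et(3)[of n] en twp assms(1) l by (auto simp: funpow_swap1)
  have f1: "(f 1 j, f 2 j) = (twist a ^^ l) (R 1 j, R 2 j)" if "3 \<le> j" "j < n" for j
    using et(3)[of j] e1[of j] that by simp
  have f1_out: "0 \<le> f 2 j" "0 \<le> f 1 j + a * f 2 j" if "3 \<le> j" "j < n" for j
    using outR[of j l] that f1[OF that, symmetric] by auto
  \<comment> \<open>In the last pair the n-th column has two negative entries, so its
    \<open>max 0\<close> terms vanish and both entries are negated. The columns j = 3, ..., n - 1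
    are still outgoing and receive their \<open>k\<close>-th twist.\<close>
  note ft = mutate_21[OF skf et(2) a0]

  have "mutate 1 (mutate 2 f) = b"
  proof (rule Quiv_eqI[OF _ bQ])
    show "mutate 1 (mutate 2 f) \<in> Quiv n" using fQ by simp
    fix i j assume ij: "1 \<le> i" "i < j" "j \<le> n"
    have pair: "(mutate 1 (mutate 2 f) 1 j, mutate 1 (mutate 2 f) 2 j) = (b 1 j, b 2 j)" if "3 \<le> j"
    proof (cases "j = n")
      case True
      then show ?thesis using ft(2,3)[of n] fn b1n assms(1) by simp
    next
      case False
      then have j: "3 \<le> j" "j < n" using that ij by auto
      then show ?thesis using ft(2,3)[of j] f1_out[OF j] twR[OF j] l f1[OF j, symmetric]
        by simp
    qed
    consider "i = 1" "j = 2" | "3 \<le> j" "i = 1" | "3 \<le> j" "i = 2"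
      | "3 \<le> i" "3 \<le> j" "j < n" | "3 \<le> i" "j = n"
      using ij by linarith
    then show "mutate 1 (mutate 2 f) i j = b i j"
    proof cases
      case 1
      then show ?thesis using ft(1) b12 by simp
    next
      case 4
      then show ?thesis
        using ft(4)[of i j] et(4)[of i j] eij[of i j] f1_out[of i] f1_out[of j] bij[of i j] ij by simp
    next
      case 5
      then have i: "3 \<le> i" "i < n" using ij by auto
      \<comment> \<open>Up to sign, the left side is the number of arrows removed by the last pair
        and the right side the number added in forming \<open>e\<close>; the \<open>l\<close> twists
        in between act on both arguments.\<close>
      have "twist_form a (f 1 i, f 2 i) (- b 1 n, - b 2 n) = twist_form a (R 1 i, R 2 i) (twist a p)"
        using twist_form_invariant[of a l "(R 1 i, R 2 i)" "twist a p"] twp l f1[OF i]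
        by (simp add: funpow_swap1)
      then have "f 2 i * b 2 n + (f 1 i + a * f 2 i) * b 1 n = R 2 i * w + R 1 i * (u + a * w)"
        using uw by (simp add: algebra_simps)
      moreover have "mutate 1 (mutate 2 f) i n
          = f i n + two_paths (f 2 i) (- b 2 n) + two_paths (f 1 i + a * f 2 i) (- b 1 n)"
        using ft(4)[of i n] fn b1n f1_out[OF i] i by simp
      ultimately show ?thesis
        using 5 i et(4)[of i n] ejn[OF i] f1_out[OF i] b1n by (simp add: two_paths_opposite)
    qed (use pair in auto)
  qed
  then have "mutate_seq (concat (replicate k [2, 1])) e = b"
    unfolding l alt_mutate_Suc f_def[symmetric] .
  then have return: "mutate_seq ([2, 1] @ concat (replicate k [2, 1])) d = b"
    by (simp add: e_def)

  \<comment> \<open>The final 2, 1 of the descent joins the trailing word, which gives k + 1 pairs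
    in all.\<close>
  have upt: "rev [1..<n] = rev [3..<n] @ [2, 1]"
  proof -
    have "[1..<n] = 1 # [2..<n]" "[2..<n] = 2 # [3..<n]"
      using upt_conv_Cons[of 1 n] upt_conv_Cons[of 2 n] assms(1)
      by (simp_all add: numeral_2_eq_2 numeral_3_eq_3)
    then show ?thesis by simp
  qed
  let ?U = "concat (replicate k [1, 2::nat])" and ?T = "concat (replicate k [2, 1::nat])"
  have seq: "cycle_seq n k = [n] @ ?U @ rev [3..<n] @ [2, 1] @ ?T"
    unfolding cycle_seq_def upt by simp
  have set_UT: "set ?U \<subseteq> {1, 2}" "set ?T \<subseteq> {1, 2}" by auto
  have "mutate_seq (cycle_seq n k) b = b"
    unfolding seq mutate_seq_append using undo sinks return by simp
  moreover have "admissible n (cycle_seq n k) b"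
  proof -
    have "\<not> isolated n b n"
      using b1n(1) skewD[OF skb, of n 1] assms(1) by (force simp: isolated_def)
    moreover have "admissible n ?U (mutate n b)"
    proof (rule admissible_12[OF set_UT(1) skew_mutate[OF skb]])
      show "mutate n b 1 2 \<noteq> 0"
        using b12 a assms(1) unfolding step_n by (simp add: sign_flip_def)
    qed (use assms(1) in simp)
    moreover have "admissible n ([2, 1] @ ?T) d"
      using skd d12 a assms(1) set_UT(2) by (intro admissible_12) auto
    ultimately show ?thesis
      unfolding seq admissible_append mutate_seq_append using undo sinks by simp
  qed
  moreover have "set (cycle_seq n k) \<subseteq> {1..n}"
    using set_UT assms(1) by (auto simp: seq)
  \<comment> \<open>For n \<ge> 4 the descent from n - 1 to 3 is nonempty and separates the 2 ending
    \<open>?U\<close> from the next 2.\<close>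
  moreover have "distinct_adj (cycle_seq n k)"
  proof -
    have "hd ?U = 1" "?U \<noteq> []" "hd ?T = 2" "?T \<noteq> []" by (simp_all add: l)
    moreover have "last ?U = 2" "last ?T = 1" unfolding l alternating_Suc by simp_all
    moreover have "hd (rev [3..<n]) = n - 1" "last (rev [3..<n]) = 3" "rev [3..<n] \<noteq> []"
      using assms(1) by (auto simp: hd_rev last_rev)
    moreover have "distinct_adj (rev [3..<n])" by (simp add: distinct_adj_conv_nth nth_eq_iff_index_eq)
    moreover have "distinct_adj ?U" "distinct_adj ?T" by (simp_all add: distinct_adj_alternating)
    ultimately show ?thesis
      using assms(1) by (simp add: seq distinct_adj_append_iff distinct_adj_Cons)
  qed
  moreover have "hd (cycle_seq n k) \<noteq> last (cycle_seq n k)"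
    using assms(1) unfolding seq unfolding l alternating_Suc by simp
  moreover have "cycle_seq n k \<noteq> []" by (simp add: seq)
  ultimately show ?thesis
    unfolding mutation_cycle_def admissible_iff_nth using cyclically_distinct by blast
qed

section \<open>Full genericity\<close>

lemma int_polynomial_const: "int_polynomial I (\<lambda>x. a)"
  unfolding int_polynomial_def
  by (rule exI[of _ "{\<lambda>_. 0}"], rule exI[of _ "\<lambda>_. a"]) simp

lemma int_polynomial_var:
  assumes "finite I" "v \<in> I"
  shows "int_polynomial I (\<lambda>x. x v)"
proof -
  have "(\<Prod>w\<in>I. x w ^ (if w = v then 1 else 0)) = x v" for x :: "'a \<Rightarrow> int"
  proof -
    have "(\<Prod>w\<in>I. x w ^ (if w = v then 1 else 0)) = (\<Prod>w\<in>I. if w = v then x w else 1)"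
      by (intro prod.cong) auto
    then show ?thesis using assms by simp
  qed
  then show ?thesis unfolding int_polynomial_def
    by (intro exI[of _ "{\<lambda>w. if w = v then 1 else 0}"] exI[of _ "\<lambda>_. 1"]) simp
qed

lemma int_polynomial_add:
  assumes "int_polynomial I p" "int_polynomial I q"
  shows "int_polynomial I (\<lambda>x. p x + q x)"
proof -
  obtain M c where M: "finite M" "\<And>x. p x = (\<Sum>m\<in>M. c m * (\<Prod>v\<in>I. x v ^ m v))"
    using assms(1) unfolding int_polynomial_def by blast
  obtain N d where N: "finite N" "\<And>x. q x = (\<Sum>m\<in>N. d m * (\<Prod>v\<in>I. x v ^ m v))"
    using assms(2) unfolding int_polynomial_def by blast
  let ?c = "\<lambda>m. (if m \<in> M then c m else 0) + (if m \<in> N then d m else 0)"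
  have "p x + q x = (\<Sum>m\<in>M \<union> N. ?c m * (\<Prod>v\<in>I. x v ^ m v))" for x
  proof -
    have "p x = (\<Sum>m\<in>M \<union> N. (if m \<in> M then c m else 0) * (\<Prod>v\<in>I. x v ^ m v))"
      unfolding M(2) using M(1) N(1) by (intro sum.mono_neutral_cong_left) auto
    moreover have "q x = (\<Sum>m\<in>M \<union> N. (if m \<in> N then d m else 0) * (\<Prod>v\<in>I. x v ^ m v))"
      unfolding N(2) using M(1) N(1) by (intro sum.mono_neutral_cong_left) auto
    ultimately show ?thesis by (simp add: distrib_right sum.distrib)
  qed
  then show ?thesis unfolding int_polynomial_def
    using M(1) N(1) by (intro exI[of _ "M \<union> N"] exI[of _ ?c]) auto
qed

lemma int_polynomial_mult:
  assumes "int_polynomial I p" "int_polynomial I q"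
  shows "int_polynomial I (\<lambda>x. p x * q x)"
proof -
  obtain M c where M: "finite M" "\<And>x. p x = (\<Sum>m\<in>M. c m * (\<Prod>v\<in>I. x v ^ m v))"
    using assms(1) unfolding int_polynomial_def by blast
  obtain N d where N: "finite N" "\<And>x. q x = (\<Sum>m\<in>N. d m * (\<Prod>v\<in>I. x v ^ m v))"
    using assms(2) unfolding int_polynomial_def by blast
  \<comment> \<open>Multiplying monomials adds exponent vectors. Different pairs may have the same
    sum, so \<open>e\<close> collects coefficients over the fibres of \<open>g\<close>.\<close>
  define g :: "('a \<Rightarrow> nat) \<times> ('a \<Rightarrow> nat) \<Rightarrow> 'a \<Rightarrow> nat" where "g = (\<lambda>(m, m') v. m v + m' v)"
  define e where "e y = (\<Sum>mm\<in>{mm \<in> M \<times> N. g mm = y}. c (fst mm) * d (snd mm))" for y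
  have fin: "finite (M \<times> N)" using M(1) N(1) by simp
  have "p x * q x = (\<Sum>y\<in>g ` (M \<times> N). e y * (\<Prod>v\<in>I. x v ^ y v))" for x
  proof -
    have "p x * q x = (\<Sum>mm\<in>M \<times> N. c (fst mm) * d (snd mm) * (\<Prod>v\<in>I. x v ^ g mm v))"
      unfolding M(2) N(2) sum_product sum.cartesian_product
      by (intro sum.cong) (auto simp: g_def power_add prod.distrib)
    also have "\<dots> = (\<Sum>y\<in>g ` (M \<times> N). \<Sum>mm\<in>{mm \<in> M \<times> N. g mm = y}.
        c (fst mm) * d (snd mm) * (\<Prod>v\<in>I. x v ^ g mm v))"
      by (rule sum.image_gen[OF fin])
    also have "\<dots> = (\<Sum>y\<in>g ` (M \<times> N). e y * (\<Prod>v\<in>I. x v ^ y v))"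
      unfolding e_def sum_distrib_right by (intro sum.cong) auto
    finally show ?thesis .
  qed
  then show ?thesis unfolding int_polynomial_def
    using fin by (intro exI[of _ "g ` (M \<times> N)"] exI[of _ e]) auto
qed

lemma int_polynomial_uminus: "int_polynomial I p \<Longrightarrow> int_polynomial I (\<lambda>x. - p x)"
  using int_polynomial_mult[OF int_polynomial_const[of I "- 1"]] by simp

lemma int_polynomial_diff:
  "int_polynomial I p \<Longrightarrow> int_polynomial I q \<Longrightarrow> int_polynomial I (\<lambda>x. p x - q x)"
  using int_polynomial_add[OF _ int_polynomial_uminus] by simp

lemmas int_polynomial_intros =
  int_polynomial_const int_polynomial_add int_polynomial_mult int_polynomial_uminus int_polynomial_diff

lemma int_polynomial_twist_pow:
  assumes "int_polynomial I a" "int_polynomial I u" "int_polynomial I w"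
  shows "int_polynomial I (\<lambda>x. fst ((twist (a x) ^^ k) (u x, w x)))"
    and "int_polynomial I (\<lambda>x. snd ((twist (a x) ^^ k) (u x, w x)))"
proof -
  have twist_proj: "fst (twist c q) = - (fst q + c * snd q)"
    "snd (twist c q) = c * (fst q + c * snd q) - snd q" for c q
    by (cases q; simp)+
  have "int_polynomial I (\<lambda>x. fst ((twist (a x) ^^ k) (u x, w x)))
      \<and> int_polynomial I (\<lambda>x. snd ((twist (a x) ^^ k) (u x, w x)))"
    by (induction k) (auto simp: twist_proj assms intro!: int_polynomial_intros)
  then show "int_polynomial I (\<lambda>x. fst ((twist (a x) ^^ k) (u x, w x)))"
    "int_polynomial I (\<lambda>x. snd ((twist (a x) ^^ k) (u x, w x)))" by auto
qed

lemma int_polynomial_untwist_pow: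
  assumes "int_polynomial I a" "int_polynomial I u" "int_polynomial I w"
  shows "int_polynomial I (\<lambda>x. fst ((untwist (a x) ^^ k) (u x, w x)))"
    and "int_polynomial I (\<lambda>x. snd ((untwist (a x) ^^ k) (u x, w x)))"
proof -
  have untwist_proj: "fst (untwist c q) = - fst q + c * (snd q + c * fst q)"
    "snd (untwist c q) = - snd q - c * fst q" for c q
    by (cases q; simp)+
  have "int_polynomial I (\<lambda>x. fst ((untwist (a x) ^^ k) (u x, w x)))
      \<and> int_polynomial I (\<lambda>x. snd ((untwist (a x) ^^ k) (u x, w x)))"
    by (induction k)
      (auto simp: untwist_proj assms simp del: add_uminus_conv_diff intro!: int_polynomial_intros)
  then show "int_polynomial I (\<lambda>x. fst ((untwist (a x) ^^ k) (u x, w x)))"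
    "int_polynomial I (\<lambda>x. snd ((untwist (a x) ^^ k) (u x, w x)))" by auto
qed

section \<open>The polynomial parametrization of the family\<close>

definition quiver_of :: "nat \<Rightarrow> (nat \<times> nat \<Rightarrow> int) \<Rightarrow> quiver" where
  "quiver_of n x = (\<lambda>i j. if (i, j) \<in> pairs n then x (i, j)
     else if (j, i) \<in> pairs n then - x (j, i) else 0)"

lemma quiver_of_Quiv: "quiver_of n x \<in> Quiv n"
  by (auto simp: Quiv_def quiver_of_def pairs_def)

lemma coords_quiver_of: "x \<in> extensional (pairs n) \<Longrightarrow> coords n (quiver_of n x) = x"
  by (auto simp: coords_def quiver_of_def extensional_def fun_eq_iff)

lemma finite_pairs: "finite (pairs n)"
  by (rule finite_subset[of _ "{1..n} \<times> {1..n}"]) (auto simp: pairs_def)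

text \<open>With the image as target, a polynomial left inverse suffices: it agrees with
  \<open>inv_into A f\<close> on that image.\<close>

lemma Z_biregularI:
  assumes "finite I" "A \<subseteq> (I \<rightarrow>\<^sub>E UNIV)" "f ` A \<subseteq> (I \<rightarrow>\<^sub>E UNIV)"
    and inv: "\<And>x. x \<in> A \<Longrightarrow> g (f x) = x"
    and f: "\<And>i. i \<in> I \<Longrightarrow> int_polynomial I (\<lambda>x. f x i)"
    and g: "\<And>i. i \<in> I \<Longrightarrow> int_polynomial I (\<lambda>x. g x i)"
  shows "Z_biregular I A (f ` A) f"
proof -
  have inj: "inj_on f A" using inv by (metis inj_onI)
  have "inv_into A f y = g y" if "y \<in> f ` A" for y
    using that inv inj by auto
  then have "given_by_int_polynomials I (f ` A) (inv_into A f)"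
    unfolding given_by_int_polynomials_def using g by metis
  moreover have "given_by_int_polynomials I A f"
    unfolding given_by_int_polynomials_def using f by blast
  ultimately show ?thesis using assms(1-3) inj by (simp add: Z_biregular_def bij_betw_imageI)
qed

text \<open>Column \<open>n\<close> is left alone, since the entries b i n are free parameters of
  the family.\<close>

definition on_columns ::
    "nat \<Rightarrow> (int \<times> int \<Rightarrow> int \<times> int) \<Rightarrow> (nat \<times> nat \<Rightarrow> int) \<Rightarrow> nat \<times> nat \<Rightarrow> int" where
  "on_columns n g x = (\<lambda>(i, j).
     if 3 \<le> j \<and> j < n \<and> i = 1 then fst (g (x (1, j), x (2, j)))
     else if 3 \<le> j \<and> j < n \<and> i = 2 then snd (g (x (1, j), x (2, j)))
     else x (i, j))"

lemma Q_family_fully_generic: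
  assumes "n \<ge> 4"
  shows "fully_generic n (Q_family n k)"
proof -
  let ?I = "pairs n"
  let ?A = "?I \<rightarrow>\<^sub>E {0::int..}"
  \<comment> \<open>Adding 2 turns nonnegative coordinates into the entries of \<open>R\<close> and
    of the n-th column; the twists with a = z (1, 2) + 2 then carry out the \<open>k\<close> pairs
    of mutations.\<close>
  define f where "f z = (\<lambda>q\<in>?I. on_columns n (twist (z (1, 2) + 2) ^^ k) (\<lambda>q. z q + 2) q)"
    for z :: "nat \<times> nat \<Rightarrow> int"
  \<comment> \<open>The coordinate (1, 2) is not twisted, so \<open>a\<close> can be read off from
    \<open>y\<close> itself, which makes the inverse polynomial.\<close>
  define g where "g y = (\<lambda>q\<in>?I. on_columns n (untwist (y (1, 2)) ^^ k) y q - 2)"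
    for y :: "nat \<times> nat \<Rightarrow> int"
  let ?S = "(\<lambda>z. quiver_of n (f z)) ` ?A"
  have I12: "(1, 2) \<in> ?I" using assms by (auto simp: pairs_def)
  have Ij: "(1, j) \<in> ?I" "(2, j) \<in> ?I" if "3 \<le> j" "j < n" for j
    using that by (auto simp: pairs_def)
  have f12: "f z (1, 2) = z (1, 2) + 2" for z using I12 by (simp add: f_def on_columns_def)
  have fj: "(f z (1, j), f z (2, j)) = (twist (z (1, 2) + 2) ^^ k) (z (1, j) + 2, z (2, j) + 2)"
    if "3 \<le> j" "j < n" for z j
    using Ij[OF that] that by (simp add: f_def on_columns_def)
  have f_other: "f z (i, j) = z (i, j) + 2" if "(i, j) \<in> ?I" "3 \<le> i \<or> j = n" for z i j
    using that by (auto simp: f_def on_columns_def)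
  note var = int_polynomial_var[OF finite_pairs]

  have gf: "g (f z) = z" if "z \<in> ?A" for z
  proof
    fix q :: "nat \<times> nat"
    obtain i j where q: "q = (i, j)" by (cases q)
    show "g (f z) q = z q"
    proof (cases "q \<in> ?I")
      case True
      show ?thesis
      proof (cases "3 \<le> j \<and> j < n \<and> (i = 1 \<or> i = 2)")
        case col: True
        then show ?thesis using True fj[of j z] f12[of z] q by (auto simp: g_def on_columns_def)
      next
        case False
        then have "f z q = z q + 2" using True q by (auto simp: f_def on_columns_def)
        then show ?thesis using True False q by (auto simp: g_def on_columns_def)
      qed
    qed (use that in \<open>auto simp: g_def\<close>)
  qed
  have f_poly: "int_polynomial ?I (\<lambda>z. f z q)" if "q \<in> ?I" for q
  proof -
    obtain i j where q: "q = (i, j)" by (cases q)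
    consider "3 \<le> j \<and> j < n \<and> i = 1" | "3 \<le> j \<and> j < n \<and> i = 2"
      | "\<not> (3 \<le> j \<and> j < n \<and> (i = 1 \<or> i = 2))" by blast
    then show ?thesis
    proof cases
      case 1
      have "int_polynomial ?I (\<lambda>z. z v + 2)" if "v \<in> ?I" for v
        using that by (intro int_polynomial_add int_polynomial_const var)
      note poly = int_polynomial_twist_pow[OF this[OF I12] this[OF Ij(1)] this[OF Ij(2)], of j j k]
      show ?thesis using 1 that q poly(1) by (simp add: f_def on_columns_def)
    next
      case 2
      have "int_polynomial ?I (\<lambda>z. z v + 2)" if "v \<in> ?I" for v
        using that by (intro int_polynomial_add int_polynomial_const var)
      note poly = int_polynomial_twist_pow[OF this[OF I12] this[OF Ij(1)] this[OF Ij(2)], of j j k]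
      show ?thesis using 2 that q poly(2) by (simp add: f_def on_columns_def)
    next
      case 3
      then have "f z q = z q + 2" for z using that q by (auto simp: f_def on_columns_def)
      then show ?thesis using that by (auto intro!: int_polynomial_intros var)
    qed
  qed
  have g_poly: "int_polynomial ?I (\<lambda>z. g z q)" if "q \<in> ?I" for q
  proof -
    obtain i j where q: "q = (i, j)" by (cases q)
    consider "3 \<le> j \<and> j < n \<and> i = 1" | "3 \<le> j \<and> j < n \<and> i = 2"
      | "\<not> (3 \<le> j \<and> j < n \<and> (i = 1 \<or> i = 2))" by blast
    then show ?thesis
    proof cases
      case 1
      note poly = int_polynomial_untwist_pow[OF var[OF I12] var[OF Ij(1)] var[OF Ij(2)], of j j k,
        THEN int_polynomial_diff[OF _ int_polynomial_const[of _ 2]]]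
      show ?thesis using 1 that q poly(1) by (simp add: g_def on_columns_def)
    next
      case 2
      note poly = int_polynomial_untwist_pow[OF var[OF I12] var[OF Ij(1)] var[OF Ij(2)], of j j k,
        THEN int_polynomial_diff[OF _ int_polynomial_const[of _ 2]]]
      show ?thesis using 2 that q poly(2) by (simp add: g_def on_columns_def)
    next
      case 3
      then have "g z q = z q - 2" for z using that q by (auto simp: g_def on_columns_def)
      then show ?thesis using that by (auto intro!: int_polynomial_intros var)
    qed
  qed
  have "Z_biregular ?I ?A (f ` ?A) f"
    by (rule Z_biregularI[OF finite_pairs _ _ gf f_poly g_poly]) (auto simp: f_def)
  moreover have "coords n ` ?S = f ` ?A"
    unfolding image_image by (intro image_cong refl coords_quiver_of) (simp add: f_def)
  moreover have "?S \<subseteq> Q_family n k"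
  proof (rule image_subsetI)
    fix z assume z: "z \<in> ?A"
    \<comment> \<open>\<open>?R\<close> is the witness required by \<open>Q_family\<close>: the
      shifted coordinates before twisting, restricted to n - 1 vertices.\<close>
    let ?b = "quiver_of n (f z)" and ?R = "quiver_of (n - 1) (\<lambda>q. z q + 2)"
    have z0: "0 \<le> z q" if "q \<in> ?I" for q using z that by auto
    have R_eq: "?R i j = z (i, j) + 2" if "1 \<le> i" "i < j" "j < n" for i j
      using that by (auto simp: quiver_of_def pairs_def)
    have b_eq: "?b i j = f z (i, j)" if "(i, j) \<in> ?I" for i j
      using that by (simp add: quiver_of_def)
    have R2: "2 \<le> ?R i j" if "1 \<le> i" "i < j" "j \<le> n - 1" for i j
      using that R_eq[of i j] z0[of "(i, j)"] by (simp add: pairs_def)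
    then have R: "abundant_acyclic (n - 1) ?R"
      by (simp add: abundant_acyclic_def quiver_of_Quiv)
    have n1: "3 \<le> n - 1" using assms by simp
    have R12: "?R 1 2 = z (1, 2) + 2" using R_eq[of 1 2] assms by simp
    have "full_subquiver {1..n - 1} ?b = alt_mutate k ?R"
    proof (rule Quiv_eqI)
      show "full_subquiver {1..n - 1} ?b \<in> Quiv (n - 1)"
        by (auto simp: Quiv_def full_subquiver_def quiver_of_def pairs_def)
      show "alt_mutate k ?R \<in> Quiv (n - 1)" by (simp add: quiver_of_Quiv)
      fix i j assume ij: "1 \<le> i" "i < j" "j \<le> n - 1"
      then have jn: "j < n" and I: "(i, j) \<in> ?I" by (auto simp: pairs_def)
      have "f z (i, j) = alt_mutate k ?R i j"
      proof -
        have col: "(f z (1, j), f z (2, j)) = (alt_mutate k ?R 1 j, alt_mutate k ?R 2 j)" if "3 \<le> j"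
          using abundant_acyclic_twist(2)[OF R n1 that, of k] fj[OF that jn, of z] R12
            R_eq[of 1 j] R_eq[of 2 j] ij that by simp
        consider "i = 1" "j = 2" | "3 \<le> j" "i = 1" | "3 \<le> j" "i = 2" | "3 \<le> i" "3 \<le> j"
          using ij by linarith
        then show ?thesis
        proof cases
          case 1
          then show ?thesis using abundant_acyclic_twist(1)[OF R n1, of k] R12 f12 by simp
        next
          case 4
          then show ?thesis
            using abundant_acyclic_twist(3)[OF R n1, of i j k] ij R_eq[of i j] f_other[OF I] jn by simp
        qed (use col in auto)
      qed
      then show "full_subquiver {1..n - 1} ?b i j = alt_mutate k ?R i j"
        using ij b_eq[OF I] by (simp add: full_subquiver_def)
    qed
    moreover have "2 \<le> ?b i n" if "i \<in> {1..n - 1}" for i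
    proof -
      have "(i, n) \<in> ?I" using that by (auto simp: pairs_def)
      then show ?thesis using b_eq[of i n] f_other[of i n z] z0[of "(i, n)"] by simp
    qed
    ultimately show "?b \<in> Q_family n k"
      unfolding Q_family_def using quiver_of_Quiv R2 by blast
  qed
  moreover have "Q_family n k \<subseteq> Quiv n" by (auto simp: Q_family_def)
  ultimately show ?thesis unfolding fully_generic_def by metis
qed

theorem theorem8p18:
  fixes n k :: nat
  assumes "n \<ge> 4" and "k \<ge> 1"
  shows "fully_generic n (Q_family n k) \<and>
         fully_generic_mutation_cycle n (Q_family n k) (cycle_seq n k)"
  using Q_family_fully_generic[OF assms(1)] Q_family_mutation_cycle[OF assms]
  by (simp add: fully_generic_mutation_cycle_def)

end
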